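(* Let $n\ge 1$, let $A$ be an $n\times n$ Markov matrix, let $V=\mathbb{R}^n$, and let $\boldsymbol{\xi}\in S2_n$ be an eigenvector of $A$ (that is, an eigenvector whose components are all nonnegative and sum to $1$). Then $V$ decomposes as the direct sum of the line spanned by $\boldsymbol{\xi}$ and $S3_n$: $$V=\operatorname{span}\{\boldsymbol{\xi}\}\oplus S3_n .$$
   Context: A real $n\times n$ matrix $A=(a_{ij})$ is called a Markov matrix if $a_{ij}\ge 0$ for all $1\le i,j\le n$ and $\sum_{i=1}^n a_{ij}=1$ for every $1\le j\le n$ (each column sums to $1$). It acts on column vectors by $X\mapsto AX$. Notation: $S2_n=\{X=(x_1,\dots,x_n)^T\in\mathbb{R}^n : \sum_{i=1}^n x_i=1,\ x_i\ge 0 \text{ for all } 1\le i\le n\}$ and $S3_n=\{X=(x_1,\dots,x_n)^T\in\mathbb{R}^n : \sum_{i=1}^n x_i=0\}$. *)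

theory Defs
  imports "HOL-Analysis.Analysis" "HOL-Library.Set_Algebras"
begin

text \<open>Matrices act on column vectors: \<open>A $ i $ j\<close> is the entry in row \<open>i\<close> and column \<open>j\<close>,
  so it is the columns of a Markov matrix that sum to 1.\<close>

definition markov_matrix :: "real^'n^'n \<Rightarrow> bool" where
  "markov_matrix A \<longleftrightarrow> (\<forall>i j. A $ i $ j \<ge> 0) \<and> (\<forall>j. (\<Sum>i\<in>UNIV. A $ i $ j) = 1)"

definition eigenvector :: "real^'n^'n \<Rightarrow> real^'n \<Rightarrow> bool" where
  "eigenvector A x \<longleftrightarrow> x \<noteq> 0 \<and> (\<exists>c. A *v x = c *\<^sub>R x)"

definition S2 :: "(real^'n) set" where
  "S2 = {x. (\<Sum>i\<in>UNIV. x $ i) = 1 \<and> (\<forall>i. x $ i \<ge> 0)}"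

definition S3 :: "(real^'n) set" where
  "S3 = {x. (\<Sum>i\<in>UNIV. x $ i) = 0}"

text \<open>Internal direct sum; \<open>U + W\<close> is the elementwise sum of sets.\<close>

definition is_direct_sum :: "'a::real_vector set \<Rightarrow> 'a set \<Rightarrow> 'a set \<Rightarrow> bool" where
  "is_direct_sum V U W \<longleftrightarrow>
     subspace V \<and> subspace U \<and> subspace W \<and> V = U + W \<and> U \<inter> W = {0}"

end

theory Submission
  imports Defs
begin

text \<open>The coordinate sum is a linear functional whose kernel is \<open>S3\<close>, and it
  takes the value 1 at every point of \<open>S2\<close>, in particular at \<xi>. A vector outside
  the kernel of a linear functional spans a complement of that kernel;
  \<open>direct_sum_span_S3\<close> carries this out.\<close>

lemma subspace_S3: "subspace (S3 :: (real^'n) set)"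
  by (auto simp: subspace_def S3_def sum.distrib simp flip: sum_distrib_left)

text \<open>Since the coordinate sum is 1 at \<open>v\<close>, sending \<open>x\<close> to its
  coordinate sum times \<open>v\<close> is the projection onto the line along
  \<open>S3\<close>.\<close>

lemma direct_sum_span_S3:
  fixes v :: "real^'n"
  assumes "(\<Sum>i\<in>UNIV. v $ i) = 1"
  shows "is_direct_sum (UNIV :: (real^'n) set) (span {v}) S3"
  unfolding is_direct_sum_def
proof (intro conjI)
  have "x \<in> span {v} + S3" for x
  proof -
    \<comment> \<open>This coefficient is forced: \<open>x - c *\<^sub>R v\<close> has coordinate
      sum \<open>s - c\<close>, which vanishes exactly for \<open>c = s\<close>.\<close>
    define s where "s = (\<Sum>i\<in>UNIV. x $ i)"
    have "s *\<^sub>R v \<in> span {v}"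
      by (simp add: span_base span_scale)
    moreover have "x - s *\<^sub>R v \<in> S3"
      using assms by (simp add: S3_def s_def sum_subtractf flip: sum_distrib_left)
    ultimately have "s *\<^sub>R v + (x - s *\<^sub>R v) \<in> span {v} + S3"
      by (rule set_plus_intro)
    then show ?thesis by simp
  qed
  then show "(UNIV :: (real^'n) set) = span {v} + S3" by blast
next
  have "x = 0" if "x \<in> span {v}" "x \<in> S3" for x
  proof -
    \<comment> \<open>The coordinate sum of \<open>k *\<^sub>R v\<close> is \<open>k\<close>, so
      membership in \<open>S3\<close> gives \<open>k = 0\<close>.\<close>
    obtain k where "x = k *\<^sub>R v" using \<open>x \<in> span {v}\<close> by (auto simp: span_singleton)
    with \<open>x \<in> S3\<close> assms show ?thesis by (simp add: S3_def flip: sum_distrib_left)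
  qed
  then show "span {v} \<inter> S3 = {0}"
    using subspace_0[OF subspace_S3] span_0 by blast
qed (simp_all add: subspace_S3)

theorem theorem6:
  fixes A :: "real^'n^'n" and \<xi> :: "real^'n"
  assumes "markov_matrix A"
    and "\<xi> \<in> S2"
    and "eigenvector A \<xi>"
  shows "is_direct_sum (UNIV :: (real^'n) set) (span {\<xi>}) S3"
  using assms(2) by (intro direct_sum_span_S3) (simp add: S2_def)

end
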